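(* For every finite word $v\in\{L,R\}^\star$, $\mathcal{E}(T_v)=P_v$. In other words, $\mathcal{L}(S_{\tau_v})=P_v$, where $\tau_v=\tau_{T_v}$.
   Context: $\{L,R\}^\star$ is the set of all finite words in the letters $L,R$, including the empty word $\varepsilon$. Measures $P_v$: for probability measures $\mu,\nu$ on $\mathbb{Z}$ with mean zero, $\Phi(\mu,\nu)(d)=\frac12\mu(d+1)+\frac12\nu(d-1)$, $\Phi_L(\mu,\nu)=(\Phi(\mu,\nu),\nu)$, $\Phi_R(\mu,\nu)=(\mu,\Phi(\mu,\nu))$. For a word $v=v_1\dots v_n$ put $P_v=\Phi\circ\Phi_{v_n}\circ\cdots\circ\Phi_{v_1}(\delta_0,\delta_0)$, with $P_\varepsilon=\Phi(\delta_0,\delta_0)=\frac12\delta_{-1}+\frac12\delta_1$. Trees: the set $\mathcal{T}$ of (full planar binary) trees is the smallest set containing $\bullet$ and containing $[T_-,T_+]$ whenever $T_-,T_+\in\mathcal{T}$. The trees $T_v$ are defined by $T_\varepsilon=[\bullet,\bullet]$ and, if $T_v=[T_v^-,T_v^+]$, then $T_{vL}=[T_v,T_v^+]$ and $T_{vR}=[T_v^-,T_v]$. Stopping times: let $\Omega$ be the space of sequences $\omega=(\omega_1,\omega_2,\dots)$ with $\omega_i\in\{-1,1\}$, with the product $\sigma$-algebra and the product $\mathbb{P}$ of the measures $\frac12\delta_{-1}+\frac12\delta_1$. Let $\xi_i(\omega)=\omega_i$, $S_0=0$, $S_n=\xi_1+\dots+\xi_n$. For $T\in\mathcal{T}$ define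 $\tau_T:\Omega\to\mathbb{N}$ recursively: $\tau_\bullet=0$, and for $T=[T_-,T_+]$, $\tau_T(\omega_1,\omega_2,\dots)=1+\tau_{T_-}(\omega_2,\omega_3,\dots)$ if $\omega_1=-1$ and $\tau_T(\omega_1,\omega_2,\dots)=1+\tau_{T_+}(\omega_2,\omega_3,\dots)$ if $\omega_1=+1$. $\mathcal{L}(X)$ denotes the law of a random variable $X$, $S_\tau(\omega)=S_{\tau(\omega)}(\omega)$, and $\mathcal{E}(T):=\mathcal{L}(S_{\tau_T})$. *)

theory Defs
  imports "HOL-Probability.Probability"
begin

datatype letter = L | R

text \<open>
  Probability measures on the integers are rendered as \<^typ>\<open>int pmf\<close>. The function argument of
  \<open>embed_pmf\<close> is always a probability mass function, see \<open>pmf_Phi\<close>. The map \<open>Phi\<close> makes sense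
  without the assumption of mean zero; it preserves that property by \<open>mean_zero_Phi\<close>, and all
  measures \<open>P v\<close> have it by \<open>mean_zero_P\<close>.
\<close>

definition Phi :: "int pmf \<Rightarrow> int pmf \<Rightarrow> int pmf" where
  "Phi \<mu> \<nu> = embed_pmf (\<lambda>d. 1/2 * pmf \<mu> (d + 1) + 1/2 * pmf \<nu> (d - 1))"

lemma
  shows pmf_Phi: "pmf (Phi \<mu> \<nu>) d = 1/2 * pmf \<mu> (d + 1) + 1/2 * pmf \<nu> (d - 1)"
    and Phi_eq_bind_pmf: "Phi \<mu> \<nu> = bind_pmf (bernoulli_pmf (1/2))
     (\<lambda>b. if b then map_pmf (\<lambda>x. x - 1) \<mu> else map_pmf (\<lambda>x. x + 1) \<nu>)" (is "_ = ?B")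
proof -
  have pmf_B: "pmf ?B d = 1/2 * pmf \<mu> (d + 1) + 1/2 * pmf \<nu> (d - 1)" for d
  proof -
    have "pmf (map_pmf (\<lambda>x. x - 1) \<mu>) ((d + 1) - 1) = pmf \<mu> (d + 1)"
      by (rule pmf_map_inj') (auto intro: injI)
    moreover have "pmf (map_pmf (\<lambda>x. x + 1) \<nu>) ((d - 1) + 1) = pmf \<nu> (d - 1)"
      by (rule pmf_map_inj') (auto intro: injI)
    ultimately show ?thesis
      by (simp add: pmf_bind)
  qed
  then have "Phi \<mu> \<nu> = embed_pmf (pmf ?B)"
    unfolding Phi_def by presburger
  also have "\<dots> = ?B"
    using type_definition.Rep_inverse[OF td_pmf_embed_pmf] .
  finally show "Phi \<mu> \<nu> = ?B" .
  with pmf_B show "pmf (Phi \<mu> \<nu>) d = 1/2 * pmf \<mu> (d + 1) + 1/2 * pmf \<nu> (d - 1)"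
    by presburger
qed

definition mean_zero :: "int pmf \<Rightarrow> bool" where
  "mean_zero \<mu> \<longleftrightarrow>
     integrable (measure_pmf \<mu>) real_of_int \<and> measure_pmf.expectation \<mu> real_of_int = 0"

lemma mean_zero_return_pmf_0: "mean_zero (return_pmf 0)"
  by (simp add: mean_zero_def integrable_measure_pmf_finite)

lemma mean_zero_Phi:
  assumes "mean_zero \<mu>" "mean_zero \<nu>"
  shows "mean_zero (Phi \<mu> \<nu>)"
proof -
  have hb: "has_bochner_integral (count_space UNIV) (\<lambda>d. pmf p d * f d) x \<longleftrightarrow>
      has_bochner_integral (measure_pmf p) f x" for p and f :: "int \<Rightarrow> real" and x
    by (subst measure_pmf_eq_density)
       (simp add: has_bochner_integral_iff integral_density integrable_density)
  have shift: "has_bochner_integral (count_space UNIV) (\<lambda>d. pmf p (d + a) * real_of_int d) (- a)"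
    if "mean_zero p" for p and a :: int
  proof -
    have "has_bochner_integral (measure_pmf p) (\<lambda>d. real_of_int d - real_of_int a) (0 - real_of_int a)"
      using that
      by (auto simp: mean_zero_def has_bochner_integral_iff)
    then have "has_bochner_integral (count_space UNIV)
        (\<lambda>d. pmf p d * (real_of_int d - real_of_int a)) (- real_of_int a)"
      by (simp add: hb)
    moreover have "bij_betw (\<lambda>d::int. d + a) UNIV UNIV"
      by (rule bij_betwI[where g = "\<lambda>d. d - a"]) auto
    ultimately show ?thesis
      using integrable_bij_count_space[of "\<lambda>d. d + a" UNIV UNIV "\<lambda>d. pmf p d * (real_of_int d - real_of_int a)"]
        integral_bij_count_space[of "\<lambda>d. d + a" UNIV UNIV "\<lambda>d. pmf p d * (real_of_int d - real_of_int a)"]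
      by (simp add: has_bochner_integral_iff)
  qed
  have "has_bochner_integral (count_space UNIV)
      (\<lambda>d. 1/2 * (pmf \<mu> (d + 1) * real_of_int d) + 1/2 * (pmf \<nu> (d + - 1) * real_of_int d))
      (1/2 * real_of_int (- 1) + 1/2 * real_of_int (- (- 1)))"
    by (intro has_bochner_integral_add has_bochner_integral_mult_right shift assms)
  then have "has_bochner_integral (count_space UNIV) (\<lambda>d. pmf (Phi \<mu> \<nu>) d * real_of_int d) 0"
    by (simp add: pmf_Phi algebra_simps)
  then show ?thesis
    unfolding hb by (simp add: mean_zero_def has_bochner_integral_iff)
qed

fun Phi_letter :: "letter \<Rightarrow> int pmf \<times> int pmf \<Rightarrow> int pmf \<times> int pmf" where
  "Phi_letter L (\<mu>, \<nu>) = (Phi \<mu> \<nu>, \<nu>)"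
| "Phi_letter R (\<mu>, \<nu>) = (\<mu>, Phi \<mu> \<nu>)"

text \<open>\<open>fold\<close> applies the map belonging to the first letter of the word first.\<close>

definition P :: "letter list \<Rightarrow> int pmf" where
  "P v = case_prod Phi (fold Phi_letter v (return_pmf 0, return_pmf 0))"

lemma mean_zero_P: "mean_zero (P v)"
proof -
  have "mean_zero (fst (fold Phi_letter v m)) \<and> mean_zero (snd (fold Phi_letter v m))"
    if "mean_zero (fst m)" "mean_zero (snd m)" for m
    using that
  proof (induction v arbitrary: m)
    case (Cons a v)
    then show ?case
      by (cases m; cases a) (auto simp: mean_zero_Phi)
  qed simp
  then show ?thesis
    unfolding P_def by (simp add: mean_zero_Phi mean_zero_return_pmf_0 split: prod.split)
       (metis fst_conv snd_conv mean_zero_Phi mean_zero_return_pmf_0)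
qed

datatype btree = Bullet | Branch btree btree

text \<open>
  The value of \<open>grow\<close> on \<open>Bullet\<close> is irrelevant: no tree \<open>T v\<close> is \<open>Bullet\<close>, as \<open>T_cases\<close> shows.
  Words are extended on the right; \<open>T_Nil\<close> and \<open>T_snoc\<close> are the recursion that characterises \<open>T\<close>.
\<close>

fun grow :: "letter \<Rightarrow> btree \<Rightarrow> btree" where
  "grow L (Branch A B) = Branch (Branch A B) B"
| "grow R (Branch A B) = Branch A (Branch A B)"
| "grow _ Bullet = Bullet"

definition T :: "letter list \<Rightarrow> btree" where
  "T v = fold grow v (Branch Bullet Bullet)"

lemma T_Nil: "T [] = Branch Bullet Bullet"
  by (simp add: T_def)

lemma T_snoc:
  assumes "T v = Branch A B"
  shows "T (v @ [L]) = Branch (T v) B" and "T (v @ [R]) = Branch A (T v)"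
  using assms by (simp_all add: T_def)

lemma T_cases:
  obtains A B where "T v = Branch A B"
proof -
  have "\<exists>A B. T v = Branch A B"
  proof (induction v rule: rev_induct)
    case (snoc x v)
    then show ?case
      by (cases x) (auto simp: T_snoc)
  qed (simp add: T_Nil)
  then show ?thesis
    using that by blast
qed

text \<open>
  The sample space consists of the streams over \<open>{-1, 1}\<close> with the product of the uniform
  distributions; \<open>shd\<close> is the first coordinate and \<open>stl\<close> the shift. Streams are indexed from 0,
  the coordinates \<open>xi i\<close> from 1.
\<close>

definition Omega :: "int stream measure" where
  "Omega = stream_space (uniform_count_measure {-1, 1})"

lemma space_Omega: "space Omega = streams {-1, 1}"
  by (simp add: Omega_def space_stream_space space_uniform_count_measure)

lemma prob_space_Omega: "prob_space Omega"
  unfolding Omega_def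
  by (intro prob_space.prob_space_stream_space prob_space_uniform_count_measure) auto

definition xi :: "nat \<Rightarrow> int stream \<Rightarrow> int" where
  "xi i \<omega> = \<omega> !! (i - 1)"

definition S :: "nat \<Rightarrow> int stream \<Rightarrow> int" where
  "S n \<omega> = (\<Sum>i=1..n. xi i \<omega>)"

primrec tau :: "btree \<Rightarrow> int stream \<Rightarrow> nat" where
  "tau Bullet \<omega> = 0"
| "tau (Branch A B) \<omega> = 1 + (if shd \<omega> = -1 then tau A (stl \<omega>) else tau B (stl \<omega>))"

lemma measurable_xi [measurable]: "xi i \<in> Omega \<rightarrow>\<^sub>M count_space UNIV"
proof -
  have "(\<lambda>x. x) \<in> uniform_count_measure {-1, 1::int} \<rightarrow>\<^sub>M count_space UNIV"
    by (auto simp: measurable_def space_uniform_count_measure sets_uniform_count_measure)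
  then show ?thesis
    unfolding xi_def Omega_def by measurable
qed

lemma measurable_S [measurable]: "S n \<in> Omega \<rightarrow>\<^sub>M count_space UNIV"
  unfolding S_def by (induction n) simp_all

lemma measurable_tau [measurable]: "tau t \<in> Omega \<rightarrow>\<^sub>M count_space UNIV"
proof (induction t)
  case (Branch A B)
  have [measurable]: "stl \<in> Omega \<rightarrow>\<^sub>M Omega"
    unfolding Omega_def by measurable
  have "shd = xi 1"
    by (simp add: xi_def fun_eq_iff)
  then have [measurable]: "shd \<in> Omega \<rightarrow>\<^sub>M count_space UNIV"
    using measurable_xi[of 1] by metis
  note [measurable] = Branch
  show ?case
    by simp
qed simp

definition stopped :: "(int stream \<Rightarrow> nat) \<Rightarrow> int stream \<Rightarrow> int" where
  "stopped t \<omega> = S (t \<omega>) \<omega>"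

lemma measurable_stopped [measurable]:
  assumes [measurable]: "t \<in> Omega \<rightarrow>\<^sub>M count_space UNIV"
  shows "stopped t \<in> Omega \<rightarrow>\<^sub>M count_space UNIV"
  unfolding stopped_def by (rule measurable_compose_countable) measurable

definition law :: "(int stream \<Rightarrow> int) \<Rightarrow> int measure" where
  "law X = distr Omega (count_space UNIV) X"

definition E :: "btree \<Rightarrow> int measure" where
  "E t = law (stopped (tau t))"

end

(* Conditioning on the first step gives E [A, B] = Phi (E A) (E B). Hence E commutes with growing
   trees: grow acts on the two subtrees of T v exactly as Phi_letter acts on the pair of measures
   that define P v. *)

theory Submission
  imports Defs
begin

lemma S_Suc_SCons: "S (Suc n) (x ## \<omega>) = x + S n \<omega>"
proof -
  \<comment> \<open>\<open>xi\<close> counts coordinates from 1 and \<open>!!\<close> from 0; after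
    reindexing, the head is the summand at 0.\<close>
  have "S (Suc n) (x ## \<omega>) = (\<Sum>i<Suc n. (x ## \<omega>) !! i)"
    unfolding S_def xi_def by (rule sum.reindex_bij_witness[of _ Suc "\<lambda>i. i - 1"]) auto
  also have "\<dots> = x + (\<Sum>i<n. \<omega> !! i)"
    by (simp only: sum.lessThan_Suc_shift) simp
  also have "(\<Sum>i<n. \<omega> !! i) = S n \<omega>"
    unfolding S_def xi_def by (rule sum.reindex_bij_witness[of _ "\<lambda>i. i - 1" Suc]) auto
  finally show ?thesis .
qed

lemma stopped_tau_Branch_SCons:
  "stopped (tau (Branch A B)) (x ## \<omega>) = x + stopped (tau (if x = -1 then A else B)) \<omega>"
  by (simp add: stopped_def S_Suc_SCons)

lemma emeasure_E: "emeasure (E t) X = emeasure Omega {\<omega> \<in> space Omega. stopped (tau t) \<omega> \<in> X}"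
  unfolding E_def law_def
  by (subst emeasure_distr) (auto intro!: arg_cong[where f = "emeasure Omega"])

text \<open>Conditioning on the first step: a random stream is a uniform letter prepended to an
  independent random stream, and the integral over that letter is a sum of two terms.\<close>

lemma emeasure_Omega:
  assumes "X \<in> sets Omega"
  shows "emeasure Omega X =
    ennreal (1/2) * emeasure Omega {\<omega> \<in> space Omega. (-1) ## \<omega> \<in> X} +
    ennreal (1/2) * emeasure Omega {\<omega> \<in> space Omega. 1 ## \<omega> \<in> X}"
proof -
  have "prob_space (uniform_count_measure {-1, 1::int})"
    by (rule prob_space_uniform_count_measure) auto
  from prob_space.emeasure_stream_space[OF this, of X] assms show ?thesis
    by (simp add: Omega_def uniform_count_measure_def nn_integral_point_measure_finite)
qed

lemma emeasure_E_Branch: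
  "emeasure (E (Branch A B)) {d} =
    ennreal (1/2) * emeasure (E A) {d + 1} + ennreal (1/2) * emeasure (E B) {d - 1}"
proof -
  let ?X = "{\<omega> \<in> space Omega. stopped (tau (Branch A B)) \<omega> \<in> {d}}"
  have "?X = stopped (tau (Branch A B)) -` {d} \<inter> space Omega"
    by auto
  also have "\<dots> \<in> sets Omega"
    by (rule measurable_sets[OF measurable_stopped[OF measurable_tau]]) simp
  finally have "emeasure Omega ?X =
      ennreal (1/2) * emeasure Omega {\<omega> \<in> space Omega. (-1) ## \<omega> \<in> ?X} +
      ennreal (1/2) * emeasure Omega {\<omega> \<in> space Omega. 1 ## \<omega> \<in> ?X}"
    by (rule emeasure_Omega)
  \<comment> \<open>After the step -1 the remaining walk must end at \<open>d + 1\<close> for the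
    total to be \<open>d\<close>.\<close>
  moreover have "{\<omega> \<in> space Omega. (-1) ## \<omega> \<in> ?X} =
      {\<omega> \<in> space Omega. stopped (tau A) \<omega> \<in> {d + 1}}"
    by (auto simp: stopped_tau_Branch_SCons space_Omega)
  moreover have "{\<omega> \<in> space Omega. 1 ## \<omega> \<in> ?X} =
      {\<omega> \<in> space Omega. stopped (tau B) \<omega> \<in> {d - 1}}"
    by (auto simp: stopped_tau_Branch_SCons space_Omega)
  ultimately show ?thesis
    by (simp only: emeasure_E)
qed

text \<open>\<open>Phi\<close> acts on pmfs while \<open>E t\<close> is a measure; this recursion
  supplies the pmf behind \<open>E t\<close>.\<close>

primrec E_pmf :: "btree \<Rightarrow> int pmf" where
  "E_pmf Bullet = return_pmf 0"
| "E_pmf (Branch A B) = Phi (E_pmf A) (E_pmf B)"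

text \<open>On a countable space point masses determine a measure, and those of \<open>E\<close>
  obey the recursion \<open>pmf_Phi\<close>.\<close>

lemma E_eq_E_pmf: "E t = measure_pmf (E_pmf t)"
proof -
  have "emeasure (E t) {d} = emeasure (E_pmf t) {d}" for d
  proof (induction t arbitrary: d)
    case Bullet
    interpret prob_space Omega
      by (rule prob_space_Omega)
    show ?case
      unfolding emeasure_E
      by (cases "d = 0") (simp_all add: stopped_def S_def emeasure_space_1 emeasure_pmf_single)
  next
    case (Branch A B)
    then show ?case
      \<comment> \<open>\<open>ennreal (1/2)\<close> has to stay in this form so that the products
        merge into \<open>ennreal\<close> of a real number.\<close>
      by (simp add: emeasure_E_Branch emeasure_pmf_single pmf_Phi del: ennreal_half
          flip: ennreal_mult)
  qed
  then show ?thesis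
    by (intro measure_eqI_countable[of _ UNIV]) (simp_all add: E_def law_def)
qed

text \<open>Arbitrary subtrees \<open>A\<close> and \<open>B\<close> are needed for the induction:
  reading a letter replaces one of them by \<open>Branch A B\<close>, and one of the two measures by
  \<open>Phi (E_pmf A) (E_pmf B)\<close>, which is \<open>E_pmf (Branch A B)\<close>.\<close>

lemma Phi_fold_Phi_letter:
  "case_prod Phi (fold Phi_letter v (E_pmf A, E_pmf B)) = E_pmf (fold grow v (Branch A B))"
proof (induction v arbitrary: A B)
  case (Cons a v)
  show ?case
    using Cons.IH[of "Branch A B" B] Cons.IH[of A "Branch A B"] by (cases a) simp_all
qed simp

theorem theorem11:
  fixes v :: "letter list"
  shows "E (T v) = measure_pmf (P v)"
  \<comment> \<open>Both folds start at \<open>Bullet\<close>, whose \<open>E_pmf\<close> is the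
    point mass at 0.\<close>
  using Phi_fold_Phi_letter[of v Bullet Bullet] by (simp add: E_eq_E_pmf P_def T_def)

end
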